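(* Let $(X,f),(Y,g)\in\mathbb{X}^d$, let $|X|$ and $|Y|$ denote the dimensions of the simplicial complexes $X$ and $Y$, let $n$ and $m$ be the numbers of vertices of $X$ and $Y$, and put $D=\max\{|X|,|Y|\}$ and $p=\max\{n,m\}$. Then the simplicial Hausdorff distance $\delta((X,f),(Y,g))$ can be computed in polynomial time, at most $O(p^{2D+2})$ (with $d$ and $D$ regarded as fixed).
   Context: $\mathbb{X}^d$ is the class of pairs $(X,f)$ where $X$ is a finite abstract simplicial complex with vertex set $X_0$ and $f:X_0\to\mathbb{R}^d$ is an injective function. $d(\cdot,\cdot)$ denotes Euclidean distance in $\mathbb{R}^d$. For $\epsilon>0$, $(X,f)$ is $\epsilon$-close to $(Y,g)$ if for every $k$ and every $k$-simplex $\sigma\in X$ there is a $k$-simplex $\tau\in Y$ such that for every vertex $v\in\sigma$ there is a vertex $w\in\tau$ with $d(f(v),g(w))<\epsilon$. The directed distance is $\vec d((X,f),(Y,g))=\inf\{\epsilon>0:(X,f)\text{ is }\epsilon\text{-close to }(Y,g)\}\in[0,\infty]$ with $\inf\emptyset=+\infty$, and $\delta((X,f),(Y,g))=\max\{\vec d((X,f),(Y,g)),\vec d((Y,g),(X,f))\}$. Computational problem: the input is the list of simplices of $X$ and $Y$ and the coordinates of the points $f(v)$, $v\in X_0$, and $g(w)$, $w\in Y_0$; the output is $\delta((X,f),(Y,g))$. Running time counts elementary operations, where computing one Euclidean distance between two points and comparing two numbers each have unit cost. *)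

theory Defs
  imports "HOL-Analysis.Analysis" "HOL-Library.Landau_Symbols"
begin

section \<open>Complexes with an injective vertex map, and the simplicial Hausdorff distance\<close>

text \<open>Simplices are nonempty, so the vertex set of \<open>X\<close> is \<open>\<Union>X\<close>. The empty complex is allowed.\<close>

definition abstract_complex :: "'v set set \<Rightarrow> bool" where
  "abstract_complex X \<longleftrightarrow>
     finite X \<and> (\<forall>\<sigma>\<in>X. finite \<sigma> \<and> \<sigma> \<noteq> {}) \<and>
     (\<forall>\<sigma>\<in>X. \<forall>\<tau>. \<tau> \<noteq> {} \<longrightarrow> \<tau> \<subseteq> \<sigma> \<longrightarrow> \<tau> \<in> X)"

definition vertex_set :: "'v set set \<Rightarrow> 'v set" where
  "vertex_set X = \<Union>X"

text \<open>The vertex map is a total function in HOL; only its values on the vertex set matter.\<close>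

definition placed_complexes :: "('v set set \<times> ('v \<Rightarrow> real ^ 'd)) set" where
  "placed_complexes = {(X, f). abstract_complex X \<and> inj_on f (vertex_set X)}"

definition simplices :: "nat \<Rightarrow> 'v set set \<Rightarrow> 'v set set" where
  "simplices k X = {\<sigma> \<in> X. card \<sigma> = k + 1}"

text \<open>The empty complex has dimension \<open>-1\<close>.\<close>

definition complex_dim :: "'v set set \<Rightarrow> int" where
  "complex_dim X = (if X = {} then -1 else int (Max (card ` X)) - 1)"

definition eps_close ::
  "real \<Rightarrow> 'v set set \<times> ('v \<Rightarrow> real ^ 'd) \<Rightarrow> 'w set set \<times> ('w \<Rightarrow> real ^ 'd) \<Rightarrow> bool" where
  "eps_close \<epsilon> = (\<lambda>(X, f) (Y, g).
     \<forall>k. \<forall>\<sigma>\<in>simplices k X. \<exists>\<tau>\<in>simplices k Y. \<forall>v\<in>\<sigma>. \<exists>w\<in>\<tau>. dist (f v) (g w) < \<epsilon>)"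

text \<open>In \<^typ>\<open>ennreal\<close> the infimum of the empty set is \<open>\<infinity>\<close>.\<close>

definition directed_dist ::
  "'v set set \<times> ('v \<Rightarrow> real ^ 'd) \<Rightarrow> 'w set set \<times> ('w \<Rightarrow> real ^ 'd) \<Rightarrow> ennreal" where
  "directed_dist A B = Inf {ennreal \<epsilon> | \<epsilon>. \<epsilon> > 0 \<and> eps_close \<epsilon> A B}"

definition simplicial_hausdorff ::
  "'v set set \<times> ('v \<Rightarrow> real ^ 'd) \<Rightarrow> 'w set set \<times> ('w \<Rightarrow> real ^ 'd) \<Rightarrow> ennreal" where
  "simplicial_hausdorff A B = max (directed_dist A B) (directed_dist B A)"


section \<open>Machine model\<close>

text \<open>
  Structured programs for a random access machine with
  \<^item> integer registers and an addressable integer memory, with addition, truncated subtraction and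
    comparison (no multiplication: with it, the unit-cost measure would be unreasonable);
  \<^item> an addressable memory of numbers in \<open>[0, \<infinity>]\<close>, which can only be copied, compared, set to \<open>0\<close> or
    \<open>\<infinity>\<close>, or set to the distance of two points;
  \<^item> a read-only memory of points, which can be accessed only through their distances.

  Each node of an expression, each elementary command and each evaluation of a branch or loop
  condition is charged one unit, so the running time counts the combinatorial bookkeeping as well
  as the distance evaluations and comparisons.
\<close>

datatype iexp =
    Const nat
  | Reg nat
  | Load iexp
  | Add iexp iexp
  | Sub iexp iexp

datatype nexp =
    Zero
  | Infty
  | Num iexp
  | Dist iexp iexp

datatype bexp =
    ILess iexp iexp
  | NLess nexp nexp
  | Neg bexp
  | Conj bexp bexp

datatype com =
    Skip
  | SetReg nat iexp
  | Store iexp iexp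
  | SetNum iexp nexp
  | Seq com com
  | Cond bexp com com
  | While bexp com

record 'a state =
  reg :: "nat \<Rightarrow> nat"
  mem :: "nat \<Rightarrow> nat"
  num :: "nat \<Rightarrow> ennreal"
  pt :: "nat \<Rightarrow> 'a"

primrec ival :: "iexp \<Rightarrow> 'a state \<Rightarrow> nat" where
  "ival (Const c) s = c"
| "ival (Reg r) s = reg s r"
| "ival (Load a) s = mem s (ival a s)"
| "ival (Add a b) s = ival a s + ival b s"
| "ival (Sub a b) s = ival a s - ival b s"

primrec nval :: "nexp \<Rightarrow> 'a::metric_space state \<Rightarrow> ennreal" where
  "nval Zero s = 0"
| "nval Infty s = \<infinity>"
| "nval (Num a) s = num s (ival a s)"
| "nval (Dist a b) s = ennreal (dist (pt s (ival a s)) (pt s (ival b s)))"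

primrec bval :: "bexp \<Rightarrow> 'a::metric_space state \<Rightarrow> bool" where
  "bval (ILess a b) s \<longleftrightarrow> ival a s < ival b s"
| "bval (NLess x y) s \<longleftrightarrow> nval x s < nval y s"
| "bval (Neg b) s \<longleftrightarrow> \<not> bval b s"
| "bval (Conj b c) s \<longleftrightarrow> bval b s \<and> bval c s"

primrec icost :: "iexp \<Rightarrow> nat" where
  "icost (Const c) = 1"
| "icost (Reg r) = 1"
| "icost (Load a) = icost a + 1"
| "icost (Add a b) = icost a + icost b + 1"
| "icost (Sub a b) = icost a + icost b + 1"

primrec ncost :: "nexp \<Rightarrow> nat" where
  "ncost Zero = 1"
| "ncost Infty = 1"
| "ncost (Num a) = icost a + 1"
| "ncost (Dist a b) = icost a + icost b + 1"

primrec bcost :: "bexp \<Rightarrow> nat" where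
  "bcost (ILess a b) = icost a + icost b + 1"
| "bcost (NLess x y) = ncost x + ncost y + 1"
| "bcost (Neg b) = bcost b + 1"
| "bcost (Conj b c) = bcost b + bcost c + 1"

text \<open>\<open>exec c s t s'\<close>: started in \<open>s\<close>, the program \<open>c\<close> halts in \<open>s'\<close> after \<open>t\<close> units of time.\<close>

inductive exec :: "com \<Rightarrow> 'a::metric_space state \<Rightarrow> nat \<Rightarrow> 'a state \<Rightarrow> bool" where
  Skip: "exec Skip s 1 s"
| SetReg: "exec (SetReg r a) s (icost a + 1) (s\<lparr>reg := (reg s)(r := ival a s)\<rparr>)"
| Store: "exec (Store a b) s (icost a + icost b + 1) (s\<lparr>mem := (mem s)(ival a s := ival b s)\<rparr>)"
| SetNum: "exec (SetNum a x) s (icost a + ncost x + 1) (s\<lparr>num := (num s)(ival a s := nval x s)\<rparr>)"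
| Seq: "exec c s t s' \<Longrightarrow> exec c' s' t' s'' \<Longrightarrow> exec (Seq c c') s (t + t') s''"
| CondTrue: "bval b s \<Longrightarrow> exec c s t s' \<Longrightarrow> exec (Cond b c c') s (bcost b + 1 + t) s'"
| CondFalse: "\<not> bval b s \<Longrightarrow> exec c' s t s' \<Longrightarrow> exec (Cond b c c') s (bcost b + 1 + t) s'"
| WhileFalse: "\<not> bval b s \<Longrightarrow> exec (While b c) s (bcost b + 1) s"
| WhileTrue: "bval b s \<Longrightarrow> exec c s t s' \<Longrightarrow> exec (While b c) s' t' s'' \<Longrightarrow>
    exec (While b c) s (bcost b + 1 + t + t') s''"

inductive_cases Skip_cases: "exec Skip s t s'"
inductive_cases SetReg_cases: "exec (SetReg r a) s t s'"
inductive_cases Store_cases: "exec (Store a b) s t s'"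
inductive_cases SetNum_cases: "exec (SetNum a x) s t s'"
inductive_cases Seq_cases: "exec (Seq c c') s t s'"
inductive_cases Cond_cases: "exec (Cond b c c') s t s'"
inductive_cases While_cases: "exec (While b c) s t s'"

lemma exec_deterministic:
  "exec c s t s' \<Longrightarrow> exec c s u r \<Longrightarrow> u = t \<and> r = s'"
proof (induction arbitrary: u r rule: exec.induct)
  case Skip then show ?case by (auto elim: Skip_cases)
next
  case SetReg then show ?case by (auto elim: SetReg_cases)
next
  case Store then show ?case by (auto elim: Store_cases)
next
  case SetNum then show ?case by (auto elim: SetNum_cases)
next
  case (Seq c s t s' c' t' s'')
  from Seq.prems show ?case by (rule Seq_cases) (use Seq.IH in fastforce)
next
  case (CondTrue b s c t s' c')
  from CondTrue.prems show ?case by (rule Cond_cases) (use CondTrue in \<open>fastforce+\<close>)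
next
  case (CondFalse b s c' t s' c)
  from CondFalse.prems show ?case by (rule Cond_cases) (use CondFalse in \<open>fastforce+\<close>)
next
  case (WhileFalse b s c)
  from WhileFalse.prems show ?case by (rule While_cases) (use WhileFalse in simp_all)
next
  case (WhileTrue b s c t s' t' s'')
  from WhileTrue.prems show ?case
  proof (rule While_cases)
    assume "\<not> bval b s"
    with WhileTrue.hyps show ?thesis by simp
  next
    fix t1 q t2
    assume u: "u = Suc (bcost b + t1 + t2)" and q: "exec c s t1 q" "exec (While b c) q t2 r"
    from WhileTrue.IH(1)[OF q(1)] have "t1 = t" "q = s'" by auto
    with u WhileTrue.IH(2) q(2) show ?thesis by auto
  qed
qed


section \<open>Input format\<close>

text \<open>
  \<open>vs\<close> enumerates the vertices of \<open>X\<close>, and \<open>ss\<close> lists every simplex exactly once, in any order,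
  each as a repetition-free list of positions in \<open>vs\<close>, again in any order.
\<close>

definition listing :: "'v list \<Rightarrow> nat list list \<Rightarrow> 'v set set \<Rightarrow> bool" where
  "listing vs ss X \<longleftrightarrow>
     distinct vs \<and> set vs = vertex_set X \<and>
     (\<forall>xs\<in>set ss. distinct xs \<and> set xs \<subseteq> {..<length vs}) \<and>
     distinct (map set ss) \<and>
     X = (\<lambda>xs. (!) vs ` set xs) ` set ss"

definition encode_complex :: "'v list \<Rightarrow> nat list list \<Rightarrow> nat list" where
  "encode_complex vs ss = length vs # length ss # concat (map (\<lambda>xs. length xs # xs) ss)"

definition list_memory :: "'b::zero list \<Rightarrow> nat \<Rightarrow> 'b" where
  "list_memory xs i = (if i < length xs then xs ! i else 0)"

text \<open>
  The vertices of both complexes are numbered from \<open>0\<close>; as the points of the second complex are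
  stored after those of the first, its \<open>j\<close>th vertex has point address \<open>length vs + j\<close>.
\<close>

definition input_state ::
  "'v list \<Rightarrow> nat list list \<Rightarrow> ('v \<Rightarrow> real ^ 'd) \<Rightarrow>
   'w list \<Rightarrow> nat list list \<Rightarrow> ('w \<Rightarrow> real ^ 'd) \<Rightarrow> (real ^ 'd) state" where
  "input_state vs ss f ws ts g =
     \<lparr>reg = (\<lambda>_. 0),
      mem = list_memory (encode_complex vs ss @ encode_complex ws ts),
      num = (\<lambda>_. 0),
      pt = list_memory (map f vs @ map g ws)\<rparr>"

end

theory Submission
  imports Defs
begin

text \<open>
  As the complexes are finite, the infimum defining the directed distance is
  \<open>max\<^sub>\<sigma> min\<^sub>\<tau> max\<^sub>v min\<^sub>w d(f v, g w)\<close>, with \<open>\<tau>\<close> ranging over the simplices of the dimension of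
  \<open>\<sigma>\<close>, and four nested loops evaluate it. A nonempty set of at most \<open>D + 1\<close> vertices is the set of
  entries of a list of length \<open>D + 1\<close>, so there are at most \<open>p^(D+1)\<close> simplices on either side and
  \<open>p^(2D+2)\<close> pairs, each of which costs a constant that depends only on \<open>D\<close>.
\<close>

section \<open>Execution with time\<close>

notation Seq (infixr ";;" 60)

text \<open>Total correctness with time: some terminating execution satisfies \<open>Q\<close>. By
  \<open>exec_deterministic\<close> it is the only execution, so \<open>run\<close> acts as a
  weakest precondition, and straight-line code can be evaluated by rewriting.\<close>

definition run :: "com \<Rightarrow> 'a::metric_space state \<Rightarrow> (nat \<Rightarrow> 'a state \<Rightarrow> bool) \<Rightarrow> bool" where
  "run c s Q \<longleftrightarrow> (\<exists>t s'. exec c s t s' \<and> Q t s')"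

lemma run_mono: "run c s R \<Longrightarrow> (\<And>t s'. R t s' \<Longrightarrow> Q t s') \<Longrightarrow> run c s Q"
  unfolding run_def by blast

lemma run_Skip [simp]: "run Skip s Q \<longleftrightarrow> Q 1 s"
  unfolding run_def by (metis exec.Skip exec_deterministic)

lemma run_SetReg [simp]:
  "run (SetReg r a) s Q \<longleftrightarrow> Q (icost a + 1) (s\<lparr>reg := (reg s)(r := ival a s)\<rparr>)"
  unfolding run_def by (metis exec.SetReg exec_deterministic)

lemma run_SetNum [simp]:
  "run (SetNum a x) s Q \<longleftrightarrow>
     Q (icost a + ncost x + 1) (s\<lparr>num := (num s)(ival a s := nval x s)\<rparr>)"
  unfolding run_def by (metis exec.SetNum exec_deterministic)

lemma run_Seq [simp]:
  "run (c ;; c') s Q \<longleftrightarrow> run c s (\<lambda>t s'. run c' s' (\<lambda>t' s''. Q (t + t') s''))"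
  unfolding run_def by (blast intro: exec.Seq elim: Seq_cases)

lemma run_Cond [simp]:
  "run (Cond b c c') s Q \<longleftrightarrow>
     (if bval b s then run c s (\<lambda>t s'. Q (bcost b + 1 + t) s')
      else run c' s (\<lambda>t s'. Q (bcost b + 1 + t) s'))"
proof (cases "bval b s")
  case True
  then show ?thesis
    unfolding run_def by (metis Cond_cases exec.CondTrue exec_deterministic)
next
  case False
  then show ?thesis
    unfolding run_def by (metis Cond_cases exec.CondFalse exec_deterministic)
qed

lemma run_While_False: "\<not> bval b s \<Longrightarrow> Q (bcost b + 1) s \<Longrightarrow> run (While b c) s Q"
  unfolding run_def by (blast intro: exec.WhileFalse)

lemma run_While_True:
  "bval b s \<Longrightarrow>
   run c s (\<lambda>t s'. run (While b c) s' (\<lambda>t' s''. Q (bcost b + 1 + t + t') s'')) \<Longrightarrow>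
   run (While b c) s Q"
  unfolding run_def by (blast intro: exec.WhileTrue)

text \<open>\<open>R\<close> and \<open>N\<close> collect what a loop may change. \<open>mem\<close>
  and \<open>pt\<close> are kept outright: the program never uses \<open>Store\<close>, and no
  command writes points.\<close>

definition frame :: "nat set \<Rightarrow> nat set \<Rightarrow> 'a state \<Rightarrow> 'a state \<Rightarrow> bool" where
  "frame R N s s' \<longleftrightarrow> mem s' = mem s \<and> pt s' = pt s \<and>
     (\<forall>r. r \<notin> R \<longrightarrow> reg s' r = reg s r) \<and> (\<forall>k. k \<notin> N \<longrightarrow> num s' k = num s k)"


section \<open>The program\<close>

text \<open>
  Registers: 0 and 1 hold the point offsets of the two complexes, 2 and 3 the addresses of the
  current simplices \<open>\<sigma>\<close> and \<open>\<tau>\<close>, 4 the address of the simplex count of the second complex,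
  5 and 6 count down the vertices of \<open>\<sigma>\<close> and \<open>\<tau>\<close>, and 7 and 8 count down the simplices.
  Number cells: 0 accumulates the maximum over \<open>\<sigma>\<close>, 1 the minimum over \<open>\<tau>\<close>, 2 the maximum over
  the vertices of \<open>\<sigma>\<close>, and 3 the minimum over the vertices of \<open>\<tau>\<close>.
\<close>

definition vertex_dist :: nexp where
  "vertex_dist = Dist (Add (Reg 0) (Load (Add (Reg 2) (Reg 5))))
     (Add (Reg 1) (Load (Add (Reg 3) (Reg 6))))"

definition decrement :: "nat \<Rightarrow> com" where
  "decrement r = SetReg r (Sub (Reg r) (Const 1))"

definition next_simplex :: "nat \<Rightarrow> com" where
  "next_simplex r = SetReg r (Add (Reg r) (Add (Load (Reg r)) (Const 1)))"

abbreviation while_pos :: "nat \<Rightarrow> com \<Rightarrow> com" where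
  "while_pos r \<equiv> While (ILess (Const 0) (Reg r))"

definition min_num :: "nat \<Rightarrow> nexp \<Rightarrow> com" where
  "min_num k x = Cond (NLess x (Num (Const k))) (SetNum (Const k) x) Skip"

definition max_num :: "nat \<Rightarrow> nexp \<Rightarrow> com" where
  "max_num k x = Cond (NLess (Num (Const k)) x) (SetNum (Const k) x) Skip"

lemma run_decrement [simp]:
  "run (decrement r) s Q \<longleftrightarrow> Q 4 (s\<lparr>reg := (reg s)(r := reg s r - 1)\<rparr>)"
  by (simp add: decrement_def eval_nat_numeral)

lemma run_next_simplex [simp]:
  "run (next_simplex r) s Q \<longleftrightarrow>
     Q 7 (s\<lparr>reg := (reg s)(r := reg s r + mem s (reg s r) + 1)\<rparr>)"
  by (simp add: next_simplex_def eval_nat_numeral)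

lemma run_while_pos:
  assumes "c = while_pos r b" "0 < reg s r"
    and "run b s (\<lambda>t s'. run c s' (\<lambda>t' s''. Q (4 + t + t') s''))"
  shows "run c s Q"
  using assms(2,3) unfolding assms(1)
  by (intro run_While_True) (simp_all add: eval_nat_numeral)

definition tau_vertex_loop :: com where
  "tau_vertex_loop = while_pos 6 (min_num 3 vertex_dist ;; decrement 6)"

definition sigma_vertex_loop :: com where
  "sigma_vertex_loop = while_pos 5
     (SetNum (Const 3) Infty ;; SetReg 6 (Load (Reg 3)) ;; tau_vertex_loop ;;
      max_num 2 (Num (Const 3)) ;; decrement 5)"

text \<open>The two negated strict comparisons test equality of the stored lengths, that is, of the
  dimensions, since simplices are listed without repetition.\<close>

definition compare_simplices :: com where
  "compare_simplices =
     Cond (Conj (Neg (ILess (Load (Reg 2)) (Load (Reg 3))))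
                (Neg (ILess (Load (Reg 3)) (Load (Reg 2)))))
       (SetNum (Const 2) Zero ;; SetReg 5 (Load (Reg 2)) ;; sigma_vertex_loop ;;
        min_num 1 (Num (Const 2)))
       Skip"

definition tau_loop :: com where
  "tau_loop = while_pos 8 (compare_simplices ;; next_simplex 3 ;; decrement 8)"

definition sigma_loop :: com where
  "sigma_loop = while_pos 7
     (SetNum (Const 1) Infty ;; SetReg 3 (Add (Reg 4) (Const 1)) ;; SetReg 8 (Load (Reg 4)) ;;
      tau_loop ;; max_num 0 (Num (Const 1)) ;; next_simplex 2 ;; decrement 7)"

definition skip_loop :: com where
  "skip_loop = while_pos 7 (next_simplex 4 ;; decrement 7)"

text \<open>\<open>skip_loop\<close> leaves register 4 at the vertex count of the second complex,
  one cell before its simplex count. The second \<open>sigma_loop\<close> runs with the complexes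
  exchanged; number cell 0 is not reset, so it ends with the maximum of both directed
  distances.\<close>

definition hausdorff_program :: com where
  "hausdorff_program =
     SetReg 4 (Const 2) ;; SetReg 7 (Load (Const 1)) ;; skip_loop ;;
     SetReg 4 (Add (Reg 4) (Const 1)) ;;
     SetReg 1 (Load (Const 0)) ;; SetReg 2 (Const 2) ;; SetReg 7 (Load (Const 1)) ;;
     sigma_loop ;;
     SetReg 0 (Reg 1) ;; SetReg 1 (Const 0) ;;
     SetReg 2 (Add (Reg 4) (Const 1)) ;; SetReg 7 (Load (Reg 4)) ;; SetReg 4 (Const 1) ;;
     sigma_loop"


section \<open>Correctness and running time\<close>

definition address_dist :: "'a::metric_space state \<Rightarrow> nat \<Rightarrow> nat \<Rightarrow> ennreal" where
  "address_dist s i k = ennreal (dist (pt s (reg s 0 + mem s (reg s 2 + i)))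
     (pt s (reg s 1 + mem s (reg s 3 + k))))"

lemma address_dist_frame:
  assumes "frame R N s s'" "R \<inter> {0,1,2,3} = {}"
  shows "address_dist s' = address_dist s"
  using assms unfolding frame_def address_dist_def by (auto intro!: ext)

lemma sup_zero_ennreal [simp]: "sup 0 (x :: ennreal) = x"
  by (metis bot_ennreal sup_bot_left)

lemma run_min_num:
  "run (min_num k x) s (\<lambda>t s'. t \<le> 2 * ncost x + 7 \<and> s' = s\<lparr>num := (num s)(k := inf (num s k) (nval x s))\<rparr>)"
  by (auto simp: min_num_def inf_min min_def)

lemma run_max_num:
  "run (max_num k x) s (\<lambda>t s'. t \<le> 2 * ncost x + 7 \<and> s' = s\<lparr>num := (num s)(k := sup (num s k) (nval x s))\<rparr>)"
  by (auto simp: max_num_def sup_max max_def)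

text \<open>Keeping the initial value of cell 3 as an accumulator makes the induction go through;
  the counter meets the largest index first. A pass costs at most 4 + 33 + 4 = 41, rounded up to 50,
  and the final 4 is the failing test.\<close>

lemma run_tau_vertex_loop:
  "run tau_vertex_loop s (\<lambda>t s'. t \<le> 50 * reg s 6 + 4 \<and> frame {6} {3} s s' \<and>
     num s' 3 = inf (num s 3) (INF k\<in>{1..reg s 6}. address_dist s (reg s 5) k))"
proof (induction "reg s 6" arbitrary: s)
  case 0
  then show ?case
    unfolding tau_vertex_loop_def by (intro run_While_False) (auto simp: frame_def)
next
  case (Suc n)
  let ?s = "s\<lparr>num := (num s)(3 := inf (num s 3) (nval vertex_dist s)), reg := (reg s)(6 := n)\<rparr>"
  have d: "nval vertex_dist s = address_dist s (reg s 5) (Suc n)" "ncost vertex_dist = 13"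
    using Suc(2) by (simp_all add: vertex_dist_def address_dist_def)
  have f: "frame {6} {3} s ?s"
    by (simp add: frame_def)
  have ad: "address_dist ?s = address_dist s"
    by (rule address_dist_frame[OF f]) auto
  have "run tau_vertex_loop ?s (\<lambda>t s'. t \<le> 50 * reg ?s 6 + 4 \<and> frame {6} {3} ?s s' \<and>
     num s' 3 = inf (num ?s 3) (INF k\<in>{1..reg ?s 6}. address_dist ?s (reg ?s 5) k))"
    by (rule Suc(1)) simp
  then have IH: "run tau_vertex_loop ?s (\<lambda>t s'. t \<le> 50 * n + 4 \<and> frame {6} {3} s s' \<and>
     num s' 3 = inf (num s 3) (INF k\<in>{1..Suc n}. address_dist s (reg s 5) k))"
    unfolding ad
    by (rule run_mono)
      (use f in \<open>auto simp: d frame_def atLeastAtMostSuc_conv inf_assoc\<close>)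
  show ?case
    apply (rule run_while_pos[OF tau_vertex_loop_def])
    subgoal using Suc(2) by simp
    apply (simp only: run_Seq)
    apply (rule run_mono[OF run_min_num])
    using Suc(2)[symmetric]
    apply (auto simp: d(2) intro!: run_mono[OF IH])
    done
qed

lemma run_sigma_vertex_loop:
  "run sigma_vertex_loop s (\<lambda>t s'. t \<le> (50 * mem s (reg s 3) + 50) * reg s 5 + 4 \<and>
     frame {5,6} {2,3} s s' \<and>
     num s' 2 = sup (num s 2)
       (SUP i\<in>{1..reg s 5}. INF k\<in>{1..mem s (reg s 3)}. address_dist s i k))"
proof (induction "reg s 5" arbitrary: s)
  case 0
  then show ?case
    unfolding sigma_vertex_loop_def
    by (intro run_While_False) (auto simp: frame_def bot_ennreal[symmetric])
next
  case (Suc n)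
  let ?m = "mem s (reg s 3)"
  let ?v = "INF k\<in>{1..?m}. address_dist s (Suc n) k"
  let ?s0 = "s\<lparr>num := (num s)(3 := top), reg := (reg s)(6 := ?m)\<rparr>"
  have ad0: "address_dist ?s0 = address_dist s"
    by (rule address_dist_frame[where R="{6}" and N="{3}"]) (auto simp: frame_def)
  have inner: "run tau_vertex_loop ?s0 (\<lambda>t s'. t \<le> 50 * ?m + 4 \<and> frame {6} {3} s s' \<and> num s' 3 = ?v)"
    by (rule run_mono[OF run_tau_vertex_loop], unfold ad0)
      (use Suc(2)[symmetric] in \<open>auto simp: frame_def\<close>)
  \<comment> \<open>The state left by the inner loop is known only up to its frame, so the induction
    hypothesis is restated for every such \<open>s1\<close>. The loops over simplices follow the
    same pattern.\<close>
  have IH: "run sigma_vertex_loop s1 (\<lambda>t s'. t \<le> (50 * ?m + 50) * n + 4 \<and>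
     frame {5,6} {2,3} s s' \<and>
     num s' 2 = sup (num s 2) (SUP i\<in>{1..Suc n}. INF k\<in>{1..?m}. address_dist s i k))"
    if f: "frame {5,6} {2,3} s s1" and "reg s1 5 = n" "num s1 2 = sup (num s 2) ?v" for s1
  proof -
    have "run sigma_vertex_loop s1 (\<lambda>t s'. t \<le> (50 * mem s1 (reg s1 3) + 50) * reg s1 5 + 4 \<and>
       frame {5,6} {2,3} s1 s' \<and>
       num s' 2 = sup (num s1 2)
         (SUP i\<in>{1..reg s1 5}. INF k\<in>{1..mem s1 (reg s1 3)}. address_dist s1 i k))"
      by (rule Suc(1)) (use that in simp)
    moreover have "address_dist s1 = address_dist s"
      by (rule address_dist_frame[OF f]) auto
    moreover have "mem s1 (reg s1 3) = ?m"
      using f by (simp add: frame_def)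
    ultimately show ?thesis
      by (elim run_mono)
        (use that in \<open>auto simp: frame_def atLeastAtMostSuc_conv sup_assoc\<close>)
  qed
  show ?case
    apply (rule run_while_pos[OF sigma_vertex_loop_def])
    subgoal using Suc(2) by simp
    apply simp
    apply (rule run_mono[OF inner])
    apply clarsimp
    apply (rule run_mono[OF run_max_num])
    apply (clarsimp)
    apply (rule run_mono[OF IH])
    using Suc(2)[symmetric]
    apply (auto simp: frame_def)
    done
qed

section \<open>Simplices in memory and the loops over them\<close>

definition stored_simplex :: "(nat \<Rightarrow> nat) \<Rightarrow> nat \<Rightarrow> nat list \<Rightarrow> bool" where
  "stored_simplex m a xs \<longleftrightarrow> m a = length xs \<and> (\<forall>k<length xs. m (a + Suc k) = xs ! k)"

primrec stored :: "(nat \<Rightarrow> nat) \<Rightarrow> nat \<Rightarrow> nat list list \<Rightarrow> bool" where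
  "stored m a [] \<longleftrightarrow> True"
| "stored m a (xs # xss) \<longleftrightarrow> stored_simplex m a xs \<and> stored m (a + length xs + 1) xss"

text \<open>Turns extrema over counter values into extrema over vertex numbers.\<close>

lemma stored_simplex_set:
  assumes "stored_simplex m a xs"
  shows "(\<lambda>i. m (a + i)) ` {1..length xs} = set xs"
proof -
  have "{1..length xs} = Suc ` {..<length xs}"
    by (metis One_nat_def image_Suc_lessThan)
  then show ?thesis
    using assms by (auto simp: stored_simplex_def set_conv_nth image_image)
qed

text \<open>The directed Hausdorff distance between the vertex images of two simplices, with
  \<open>a\<close> and \<open>b\<close> the point offsets of their complexes.\<close>

definition simplex_dist ::
  "(nat \<Rightarrow> 'a::metric_space) \<Rightarrow> nat \<Rightarrow> nat \<Rightarrow> nat list \<Rightarrow> nat list \<Rightarrow> ennreal" where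
  "simplex_dist P a b xs ys = (SUP x\<in>set xs. INF y\<in>set ys. ennreal (dist (P (a + x)) (P (b + y))))"

text \<open>If no simplex of the right dimension exists, the infimum is \<open>top\<close>, in
  agreement with the convention for the directed distance.\<close>

definition nearest_dist ::
  "(nat \<Rightarrow> 'a::metric_space) \<Rightarrow> nat \<Rightarrow> nat \<Rightarrow> nat list list \<Rightarrow> nat list \<Rightarrow> ennreal" where
  "nearest_dist P a b yss xs =
     (INF ys\<in>{ys \<in> set yss. length ys = length xs}. simplex_dist P a b xs ys)"

text \<open>The singleton list \<open>[ys]\<close> covers both branches by one formula: for
  different lengths its \<open>nearest_dist\<close> is \<open>top\<close>, which is neutral for
  \<open>inf\<close>.\<close>

lemma run_compare_simplices:
  assumes "stored_simplex (mem s) (reg s 2) xs" "stored_simplex (mem s) (reg s 3) ys"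
    and "length xs \<le> K"
  shows "run compare_simplices s (\<lambda>t s'. t \<le> (50 * K + 50) * K + 50 \<and>
     frame {5,6} {1,2,3} s s' \<and>
     num s' 1 = inf (num s 1) (nearest_dist (pt s) (reg s 0) (reg s 1) [ys] xs))"
proof (cases "length ys = length xs")
  case False
  then have "{zs \<in> set [ys]. length zs = length xs} = {}"
    by auto
  then have "nearest_dist (pt s) (reg s 0) (reg s 1) [ys] xs = top"
    unfolding nearest_dist_def by simp
  with False assms show ?thesis
    by (auto simp: compare_simplices_def stored_simplex_def frame_def)
next
  case True
  then have eq: "{zs. zs = ys \<and> length zs = length xs} = {ys}"
    by auto
  let ?s0 = "s\<lparr>num := (num s)(2 := 0), reg := (reg s)(5 := length xs)\<rparr>"
  have ad0: "address_dist ?s0 = address_dist s"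
    by (rule address_dist_frame[where R="{5}" and N="{2}"]) (auto simp: frame_def)
  have len: "mem s (reg s 2) = length xs" "mem s (reg s 3) = length xs"
    using assms True by (simp_all add: stored_simplex_def)
  have "(SUP i\<in>{1..length xs}. INF k\<in>{1..length ys}. address_dist s i k)
     = (SUP x\<in>(\<lambda>i. mem s (reg s 2 + i)) ` {1..length xs}.
          INF y\<in>(\<lambda>i. mem s (reg s 3 + i)) ` {1..length ys}.
            ennreal (dist (pt s (reg s 0 + x)) (pt s (reg s 1 + y))))"
    by (simp add: image_image address_dist_def)
  also have "\<dots> = simplex_dist (pt s) (reg s 0) (reg s 1) xs ys"
    unfolding stored_simplex_set[OF assms(1)] stored_simplex_set[OF assms(2)] simplex_dist_def ..
  finally have sd: "(SUP i\<in>{1..length xs}. INF k\<in>{1..length xs}. address_dist s i k)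
     = simplex_dist (pt s) (reg s 0) (reg s 1) xs ys"
    using True by simp
  have "(50 * length xs + 50) * length xs \<le> (50 * K + 50) * K"
    using assms(3) by (intro mult_le_mono) auto
  then have inner: "run sigma_vertex_loop ?s0 (\<lambda>t s'. t \<le> (50 * K + 50) * K + 4 \<and>
      frame {5,6} {2,3} s s' \<and> num s' 2 = simplex_dist (pt s) (reg s 0) (reg s 1) xs ys)"
    by (intro run_mono[OF run_sigma_vertex_loop], unfold ad0)
      (use sd len in \<open>auto simp: frame_def\<close>)
  show ?thesis
    unfolding compare_simplices_def
    using len apply simp
    apply (rule run_mono[OF inner])
    apply clarsimp
    apply (rule run_mono[OF run_min_num])
    apply (auto simp: frame_def nearest_dist_def eq)
    done
qed

lemma run_tau_loop:
  assumes "stored_simplex (mem s) (reg s 2) xs" "stored (mem s) (reg s 3) yss"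
    and "reg s 8 = length yss" "length xs \<le> K"
  shows "run tau_loop s (\<lambda>t s'. t \<le> ((50 * K + 50) * K + 70) * length yss + 4 \<and>
     frame {3,5,6,8} {1,2,3} s s' \<and>
     num s' 1 = inf (num s 1) (nearest_dist (pt s) (reg s 0) (reg s 1) yss xs))"
  using assms(1-3)
proof (induction yss arbitrary: s)
  case Nil
  then show ?case
    unfolding tau_loop_def nearest_dist_def
    by (intro run_While_False) (auto simp: frame_def)
next
  case (Cons ys yss)
  \<comment> \<open>Splitting off the head as \<open>[ys]\<close> produces the value computed by
    \<open>run_compare_simplices\<close>.\<close>
  have "nearest_dist P a b (ys # yss) xs = inf (nearest_dist P a b [ys] xs) (nearest_dist P a b yss xs)"
    for P :: "nat \<Rightarrow> 'a" and a b
    unfolding nearest_dist_def INF_union[symmetric] by (rule INF_cong) auto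
  note nearest = this
  have y: "stored_simplex (mem s) (reg s 3) ys" "stored (mem s) (reg s 3 + length ys + 1) yss"
    "mem s (reg s 3) = length ys"
    using Cons.prems by (auto simp: stored_simplex_def)
  have IH: "run tau_loop s1 (\<lambda>t s'. t \<le> ((50 * K + 50) * K + 70) * length yss + 4 \<and>
     frame {3,5,6,8} {1,2,3} s s' \<and>
     num s' 1 = inf (num s 1) (nearest_dist (pt s) (reg s 0) (reg s 1) (ys # yss) xs))"
    if f: "frame {3,5,6,8} {1,2,3} s s1" and r: "reg s1 3 = reg s 3 + length ys + 1"
      "reg s1 8 = length yss"
      "num s1 1 = inf (num s 1) (nearest_dist (pt s) (reg s 0) (reg s 1) [ys] xs)" for s1
    by (rule run_mono[OF Cons.IH])
      (use f r y Cons.prems in \<open>auto simp: frame_def nearest[of _ _ _] inf_assoc\<close>)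
  show ?case
    apply (rule run_while_pos[OF tau_loop_def])
    subgoal using Cons.prems by simp
    apply simp
    apply (rule run_mono[OF run_compare_simplices[OF Cons.prems(1) y(1) assms(4)]])
    apply (clarsimp)
    apply (rule run_mono[OF IH])
    using Cons.prems y
    apply (auto simp: frame_def)
    done
qed

text \<open>The initial value of cell 0 enters the result, so that a second call can continue the
  maximum of the first.\<close>

lemma run_sigma_loop:
  assumes "stored (mem s) (reg s 2) xss" "stored (mem s) (reg s 4 + 1) yss"
    and "reg s 7 = length xss" "mem s (reg s 4) = length yss"
    and "\<forall>xs\<in>set xss. length xs \<le> K"
  shows "run sigma_loop s (\<lambda>t s'.
     t \<le> (((50 * K + 50) * K + 70) * length yss + 50) * length xss + 4 \<and>
     frame {2,3,5,6,7,8} {0,1,2,3} s s' \<and>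
     num s' 0 = sup (num s 0) (SUP xs\<in>set xss. nearest_dist (pt s) (reg s 0) (reg s 1) yss xs))"
  using assms
proof (induction xss arbitrary: s)
  case Nil
  then show ?case
    unfolding sigma_loop_def
    by (intro run_While_False) (auto simp: frame_def bot_ennreal[symmetric])
next
  case (Cons xs xss)
  let ?v = "nearest_dist (pt s) (reg s 0) (reg s 1) yss xs"
  have x: "stored_simplex (mem s) (reg s 2) xs" "stored (mem s) (reg s 2 + length xs + 1) xss"
    "mem s (reg s 2) = length xs" "length xs \<le> K"
    using Cons.prems by (auto simp: stored_simplex_def)
  let ?s0 = "s\<lparr>num := (num s)(1 := top),
    reg := (reg s)(3 := Suc (reg s 4), 8 := length yss)\<rparr>"
  have inner: "run tau_loop ?s0 (\<lambda>t s'. t \<le> ((50 * K + 50) * K + 70) * length yss + 4 \<and>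
     frame {3,5,6,8} {1,2,3} s s' \<and> num s' 1 = ?v)"
    by (rule run_mono[OF run_tau_loop[where xs = xs and yss = yss and K = K]])
      (use x Cons.prems in \<open>auto simp: frame_def\<close>)
  have IH: "run sigma_loop s1 (\<lambda>t s'.
     t \<le> (((50 * K + 50) * K + 70) * length yss + 50) * length xss + 4 \<and>
     frame {2,3,5,6,7,8} {0,1,2,3} s s' \<and>
     num s' 0 = sup (num s 0)
       (SUP xs\<in>set (xs # xss). nearest_dist (pt s) (reg s 0) (reg s 1) yss xs))"
    if f: "frame {2,3,5,6,7,8} {0,1,2,3} s s1" and r: "reg s1 2 = reg s 2 + length xs + 1"
      "reg s1 7 = length xss" "num s1 0 = sup (num s 0) ?v" for s1
    by (rule run_mono[OF Cons.IH])
      (use f r x Cons.prems in \<open>auto simp: frame_def sup_assoc\<close>)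
  show ?case
    apply (rule run_while_pos[OF sigma_loop_def])
    subgoal using Cons.prems by simp
    using Cons.prems apply simp
    apply (rule run_mono[OF inner[unfolded One_nat_def]])
    apply clarsimp
    apply (rule run_mono[OF run_max_num])
    apply (clarsimp)
    apply (rule run_mono[OF IH])
    using Cons.prems x
    apply (auto simp: frame_def)
    done
qed

section \<open>Finding the second complex and running both directions\<close>

abbreviation encode_simplices :: "nat list list \<Rightarrow> nat list" where
  "encode_simplices xss \<equiv> concat (map (\<lambda>xs. length xs # xs) xss)"

lemma run_skip_loop:
  assumes "stored (mem s) (reg s 4) xss" "reg s 7 = length xss"
  shows "run skip_loop s (\<lambda>t s'. t \<le> 20 * length xss + 4 \<and> frame {4,7} {} s s' \<and>
     reg s' 4 = reg s 4 + length (encode_simplices xss))"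
  using assms
proof (induction xss arbitrary: s)
  case Nil
  then show ?case
    unfolding skip_loop_def by (intro run_While_False) (auto simp: frame_def)
next
  case (Cons xs xss)
  have IH: "run skip_loop s1 (\<lambda>t s'. t \<le> 20 * length xss + 4 \<and> frame {4,7} {} s s' \<and>
     reg s' 4 = reg s 4 + length (encode_simplices (xs # xss)))"
    if "frame {4,7} {} s s1" "reg s1 4 = reg s 4 + length xs + 1" "reg s1 7 = length xss" for s1
    by (rule run_mono[OF Cons.IH]) (use that Cons.prems in \<open>auto simp: frame_def\<close>)
  show ?case
    apply (rule run_while_pos[OF skip_loop_def])
    subgoal using Cons.prems by simp
    using Cons.prems
    apply (clarsimp simp:  stored_simplex_def)
    apply (rule run_mono[OF IH])
    apply (auto simp: frame_def)
    done
qed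

text \<open>The prefix is arbitrary because the induction moves each simplex already read into
  \<open>pre\<close>.\<close>

lemma stored_list_memory:
  assumes "a = length pre"
  shows "stored (list_memory (pre @ encode_simplices xss @ post)) a xss"
  using assms
proof (induction xss arbitrary: pre a)
  case (Cons xs xss)
  have "stored (list_memory ((pre @ length xs # xs) @ encode_simplices xss @ post))
      (a + length xs + 1) xss"
    by (rule Cons.IH) (simp add: Cons.prems)
  moreover have "stored_simplex (list_memory (pre @ encode_simplices (xs # xss) @ post)) a xs"
    by (auto simp: stored_simplex_def list_memory_def nth_append Cons.prems)
  ultimately show ?case
    by simp
qed simp

lemma run_hausdorff_program:
  assumes s: "s = input_state vs ss f ws ts g"
    and K: "\<forall>xs\<in>set ss. length xs \<le> K" "\<forall>xs\<in>set ts. length xs \<le> K"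
    and N: "length ss \<le> N" "length ts \<le> N" "1 \<le> N"
  shows "run hausdorff_program s (\<lambda>t s'. t \<le> (100 * K * K + 100 * K + 400) * N ^ 2 \<and>
     num s' 0 = sup (SUP xs\<in>set ss. nearest_dist (pt s) 0 (length vs) ts xs)
       (SUP ys\<in>set ts. nearest_dist (pt s) (length vs) 0 ss ys))"
proof -
  define m where "m = mem s"
  have m: "m = list_memory (encode_complex vs ss @ encode_complex ws ts)"
    by (simp add: m_def s input_state_def)
  \<comment> \<open>The address of the second complex: 2 counts the header of the first. Its simplex
    count is at \<open>e + 1\<close> and its first simplex at \<open>e + 2\<close>.\<close>
  define e where "e = 2 + length (encode_simplices ss)"
  have stored: "stored m 2 ss" "stored m (e + 2) ts"
    unfolding m encode_complex_def
    using stored_list_memory[of 2 "[length vs, length ss]" ss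
        "length ws # length ts # encode_simplices ts"]
      stored_list_memory[of "e + 2" "length vs # length ss # encode_simplices ss @
        [length ws, length ts]" ts "[]"]
    by (simp_all add: e_def)
  have heads: "m 0 = length vs" "m (Suc 0) = length ss" "m (Suc e) = length ts"
    unfolding m encode_complex_def by (simp_all add: list_memory_def e_def nth_append)
  have init: "reg s r = 0" "num s r = 0" "mem s = m" for r
    by (simp_all add: s input_state_def m_def)
  let ?A = "SUP xs\<in>set ss. nearest_dist (pt s) 0 (length vs) ts xs"
  let ?B = "SUP ys\<in>set ts. nearest_dist (pt s) (length vs) 0 ss ys"
  let ?c = "(50 * K + 50) * K + 70"
  have mult: "length ss * length ts \<le> N ^ 2" "length ss \<le> N ^ 2" "1 \<le> N ^ 2"
    using mult_le_mono[OF N(1) N(2)] mult_le_mono[OF N(1) N(3)] N(3)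
    by (simp_all add: power2_eq_square)
  have mult': "length ts \<le> N ^ 2"
    using mult_le_mono[OF N(2) N(3)] by (simp add: power2_eq_square)
  have skip: "run skip_loop s1 (\<lambda>t s'. t \<le> 20 * N ^ 2 + 4 \<and> frame {4,7} {} s s' \<and> reg s' 4 = e)"
    if "frame {4,7} {} s s1" "reg s1 4 = 2" "reg s1 7 = length ss" for s1
    by (rule run_mono[OF run_skip_loop[where xss = ss]])
      (use that stored init mult in \<open>auto simp: frame_def e_def\<close>)
  have cost: "(?c * length ts + 50) * length ss + 4 \<le> (?c + 50) * N ^ 2 + 4"
  proof -
    have "(?c * length ts + 50) * length ss = ?c * (length ss * length ts) + 50 * length ss"
      by (simp add: algebra_simps)
    also have "\<dots> \<le> ?c * N ^ 2 + 50 * N ^ 2"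
      using mult by (intro add_mono mult_le_mono) auto
    finally show ?thesis
      by (simp add: algebra_simps)
  qed
  have cost': "(?c * length ss + 50) * length ts + 4 \<le> (?c + 50) * N ^ 2 + 4"
  proof -
    have "(?c * length ss + 50) * length ts = ?c * (length ss * length ts) + 50 * length ts"
      by (simp add: algebra_simps)
    also have "\<dots> \<le> ?c * N ^ 2 + 50 * N ^ 2"
      using mult mult' by (intro add_mono mult_le_mono) auto
    finally show ?thesis
      by (simp add: algebra_simps)
  qed
  have first: "run sigma_loop s1 (\<lambda>t s'. t \<le> (?c + 50) * N ^ 2 + 4 \<and>
      mem s' = m \<and> pt s' = pt s \<and> reg s' 1 = length vs \<and> reg s' 4 = Suc e \<and> num s' 0 = ?A)"
    if "mem s1 = m" "pt s1 = pt s" "reg s1 0 = 0" "reg s1 1 = length vs" "reg s1 2 = 2"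
      "reg s1 4 = Suc e" "reg s1 7 = length ss" "num s1 0 = 0" for s1
    by (rule run_mono[OF run_sigma_loop[where xss = ss and yss = ts and K = K]])
      (use that stored heads K order_trans[OF _ cost] in \<open>auto simp: frame_def\<close>)
  have second: "run sigma_loop s1 (\<lambda>t s'. t \<le> (?c + 50) * N ^ 2 + 4 \<and> num s' 0 = sup ?A ?B)"
    if "mem s1 = m" "pt s1 = pt s" "reg s1 0 = length vs" "reg s1 1 = 0" "reg s1 2 = e + 2"
      "reg s1 4 = 1" "reg s1 7 = length ts" "num s1 0 = ?A" for s1
    by (rule run_mono[OF run_sigma_loop[where xss = ts and yss = ss and K = K]])
      (use that stored heads K order_trans[OF _ cost'] in \<open>auto simp: frame_def numeral_2_eq_2\<close>)
  \<comment> \<open>The 80 exceeds the cost of all commands outside the loops plus their final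
    tests; \<open>1 \<le> N\<close> absorbs it into the quadratic term.\<close>
  have total: "t \<le> (100 * K * K + 100 * K + 400) * N ^ 2"
    if "t \<le> 20 * N ^ 2 + 2 * ((?c + 50) * N ^ 2) + 80" for t
  proof -
    have "20 * N ^ 2 + 2 * ((?c + 50) * N ^ 2) + 80 \<le>
        20 * N ^ 2 + 2 * ((?c + 50) * N ^ 2) + 80 * N ^ 2"
      using mult by simp
    also have "\<dots> \<le> (100 * K * K + 100 * K + 400) * N ^ 2"
      by (simp add: algebra_simps)
    finally show ?thesis
      using that by simp
  qed
  show ?thesis
    unfolding hausdorff_program_def
    apply (simp add: init heads)
    apply (rule run_mono[OF skip])
    apply (simp_all add: frame_def init)
    apply (elim conjE)
    apply (rule run_mono[OF first])
    apply (simp_all add: init heads)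
    apply (elim conjE)
    apply (rule run_mono[OF second])
    apply (simp_all add: init heads)
    apply (rule total)
    apply simp
    done
qed


section \<open>The distance as an iterated extremum\<close>

text \<open>A finite nonempty supremum is attained, so strictness survives; \<open>0 < e\<close>
  handles the empty set, whose supremum is 0.\<close>

lemma finite_SUP_less_iff:
  fixes h :: "'a \<Rightarrow> ennreal"
  assumes "finite A" "0 < e"
  shows "(SUP a\<in>A. h a) < e \<longleftrightarrow> (\<forall>a\<in>A. h a < e)"
  using assms by (induction A rule: finite_induct) (auto simp: sup_max bot_ennreal)

text \<open>Density of the order on \<open>ennreal\<close>. For \<open>S = \<infinity>\<close> the
  set is empty and both sides are infinite.\<close>

lemma Inf_ennreal_greater:
  "Inf {ennreal e | e. e > 0 \<and> S < ennreal e} = S"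
proof (rule antisym)
  show "S \<le> Inf {ennreal e | e. e > 0 \<and> S < ennreal e}"
    by (rule Inf_greatest) auto
  show "Inf {ennreal e | e. e > 0 \<and> S < ennreal e} \<le> S"
  proof (rule dense_ge)
    fix y
    assume "S < y"
    then obtain z where z: "S < z" "z < y"
      using dense by blast
    \<comment> \<open>\<open>z\<close> is finite because it lies strictly below
      \<open>y\<close>.\<close>
    then obtain e where e: "z = ennreal e" "0 \<le> e"
      by (cases z) auto
    with z have "e > 0"
      by (metis ennreal_0 less_eq_real_def not_less_zero)
    with z e have "Inf {ennreal e | e. e > 0 \<and> S < ennreal e} \<le> z"
      by (intro Inf_lower) auto
    with z show "Inf {ennreal e | e. e > 0 \<and> S < ennreal e} \<le> y"
      by simp
  qed
qed

text \<open>A strict bound passes through any infimum, and through the suprema because they are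
  finite. Hence \<open>eps_close e\<close> says exactly that the iterated extremum is below
  \<open>e\<close>, and the infimum of such \<open>e\<close> is that extremum.\<close>

lemma directed_dist_eq:
  assumes "abstract_complex X"
  shows "directed_dist (X, f) (Y, g) =
    (SUP \<sigma>\<in>X. INF \<tau>\<in>{\<tau>\<in>Y. card \<tau> = card \<sigma>}. SUP v\<in>\<sigma>. INF w\<in>\<tau>. ennreal (dist (f v) (g w)))"
    (is "_ = ?S")
proof -
  have X: "finite X" "\<And>\<sigma>. \<sigma> \<in> X \<Longrightarrow> finite \<sigma> \<and> \<sigma> \<noteq> {}"
    using assms by (auto simp: abstract_complex_def)
  have "eps_close e (X, f) (Y, g) \<longleftrightarrow> ?S < ennreal e" if "e > 0" for e
  proof -
    have "?S < ennreal e \<longleftrightarrow> (\<forall>\<sigma>\<in>X. \<exists>\<tau>\<in>{\<tau>\<in>Y. card \<tau> = card \<sigma>}.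
        (SUP v\<in>\<sigma>. INF w\<in>\<tau>. ennreal (dist (f v) (g w))) < ennreal e)"
      using X that by (simp add: finite_SUP_less_iff INF_less_iff)
    also have "\<dots> \<longleftrightarrow> (\<forall>\<sigma>\<in>X. \<exists>\<tau>\<in>{\<tau>\<in>Y. card \<tau> = card \<sigma>}. \<forall>v\<in>\<sigma>. \<exists>w\<in>\<tau>. dist (f v) (g w) < e)"
      using X that
      by (intro ball_cong bex_cong refl) (simp add: finite_SUP_less_iff INF_less_iff ennreal_less_iff)
    also have "\<dots> \<longleftrightarrow> eps_close e (X, f) (Y, g)"
    proof -
      \<comment> \<open>Simplices are nonempty, so quantifying over \<open>k\<close> reaches all of
        them.\<close>
      have "\<exists>k. card \<sigma> = k + 1" if "\<sigma> \<in> X" for \<sigma>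
        using X(2)[OF that] by (metis Suc_eq_plus1 card_0_eq not0_implies_Suc)
      then show ?thesis
        by (fastforce simp: eps_close_def simplices_def)
    qed
    finally show ?thesis ..
  qed
  then have "{ennreal e | e. e > 0 \<and> eps_close e (X, f) (Y, g)} = {ennreal e | e. e > 0 \<and> ?S < ennreal e}"
    by blast
  then show ?thesis
    unfolding directed_dist_def by (simp only: Inf_ennreal_greater)
qed

text \<open>Passes from vertices to positions in the listings. Leaving \<open>P\<close>,
  \<open>a\<close> and \<open>b\<close> general lets one lemma serve both directions.\<close>

lemma directed_dist_listing:
  assumes X: "abstract_complex X" "listing vs ss X" and Y: "listing ws ts Y"
    and P: "\<And>i. i < length vs \<Longrightarrow> P (a + i) = f (vs ! i)"
      "\<And>i. i < length ws \<Longrightarrow> P (b + i) = g (ws ! i)"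
  shows "directed_dist (X, f) (Y, g) = (SUP xs\<in>set ss. nearest_dist P a b ts xs)"
proof -
  \<comment> \<open>Positions address distinct vertices, so the length test of the program compares
    cardinalities.\<close>
  have len: "card ((!) us ` set xs) = length xs" if "listing us qs Z" "xs \<in> set qs"
    for us :: "'u list" and qs xs Z
  proof -
    from that have "distinct us" "distinct xs" "set xs \<subseteq> {..<length us}"
      by (auto simp: listing_def)
    then show ?thesis
      using card_image[OF inj_on_nth[of us "set xs"]] distinct_card[of xs] by auto
  qed
  have "(SUP xs\<in>set ss. nearest_dist P a b ts xs) =
    (SUP xs\<in>set ss. INF \<tau>\<in>{\<tau>\<in>Y. card \<tau> = card ((!) vs ` set xs)}.
       SUP v\<in>(!) vs ` set xs. INF w\<in>\<tau>. ennreal (dist (f v) (g w)))"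
  proof (intro SUP_cong refl)
    fix xs
    assume xs: "xs \<in> set ss"
    have xsV: "set xs \<subseteq> {..<length vs}"
      using X(2) xs by (auto simp: listing_def)
    have "{\<tau>\<in>Y. card \<tau> = card ((!) vs ` set xs)} =
        (\<lambda>ys. (!) ws ` set ys) ` {ys \<in> set ts. length ys = length xs}"
      using Y len[OF X(2) xs] len[OF Y] by (auto simp: listing_def)
    then have "(INF \<tau>\<in>{\<tau>\<in>Y. card \<tau> = card ((!) vs ` set xs)}.
        SUP v\<in>(!) vs ` set xs. INF w\<in>\<tau>. ennreal (dist (f v) (g w))) =
      (INF ys\<in>{ys \<in> set ts. length ys = length xs}.
        SUP i\<in>set xs. INF j\<in>set ys. ennreal (dist (f (vs ! i)) (g (ws ! j))))"
      by (simp add: image_image)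
    also have "\<dots> = nearest_dist P a b ts xs"
      unfolding nearest_dist_def simplex_dist_def
    proof (intro INF_cong SUP_cong refl)
      fix ys i j
      assume "ys \<in> {ys \<in> set ts. length ys = length xs}" "i \<in> set xs" "j \<in> set ys"
      then have "i < length vs" "j < length ws"
        using xsV Y by (auto simp: listing_def)
      then show "ennreal (dist (f (vs ! i)) (g (ws ! j))) = ennreal (dist (P (a + i)) (P (b + j)))"
        by (simp add: P)
    qed
    finally show "nearest_dist P a b ts xs = (INF \<tau>\<in>{\<tau>\<in>Y. card \<tau> = card ((!) vs ` set xs)}.
       SUP v\<in>(!) vs ` set xs. INF w\<in>\<tau>. ennreal (dist (f v) (g w)))" ..
  qed
  also have "\<dots> = directed_dist (X, f) (Y, g)"
  proof -
    have "X = (\<lambda>xs. (!) vs ` set xs) ` set ss"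
      using X(2) by (simp add: listing_def)
    then show ?thesis
      unfolding directed_dist_eq[OF X(1)] by (simp only: image_image)
  qed
  finally show ?thesis ..
qed

section \<open>Counting simplices\<close>

lemma card_simplices_le:
  assumes "abstract_complex X" "\<And>\<sigma>. \<sigma> \<in> X \<Longrightarrow> card \<sigma> \<le> K"
  shows "card X \<le> card (vertex_set X) ^ K"
proof -
  let ?L = "{xs. set xs \<subseteq> vertex_set X \<and> length xs = K}"
  have fin: "finite (vertex_set X)"
    using assms(1) by (auto simp: abstract_complex_def vertex_set_def)
  have "X \<subseteq> set ` ?L"
  proof
    fix \<sigma>
    assume s: "\<sigma> \<in> X"
    then have "finite \<sigma>" "\<sigma> \<noteq> {}"
      using assms(1) by (auto simp: abstract_complex_def)
    obtain xs where xs: "set xs = \<sigma>" "distinct xs"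
      using finite_distinct_list[OF \<open>finite \<sigma>\<close>] by blast
    then have hd: "hd xs \<in> \<sigma>"
      using \<open>\<sigma> \<noteq> {}\<close> hd_in_set by fastforce
    have "length xs \<le> K"
      using assms(2)[OF s] distinct_card[OF xs(2)] xs(1) by simp
    moreover have "\<sigma> \<subseteq> vertex_set X"
      using s by (auto simp: vertex_set_def)
    \<comment> \<open>Padding with a vertex already in the simplex reaches length \<open>K\<close>
      without changing the set of entries.\<close>
    ultimately have "replicate (K - length xs) (hd xs) @ xs \<in> ?L"
      using xs(1) hd by (auto simp: set_replicate_conv_if)
    moreover have "set (replicate (K - length xs) (hd xs) @ xs) = \<sigma>"
      using xs(1) hd by (auto simp: set_replicate_conv_if)
    ultimately show "\<sigma> \<in> set ` ?L"
      by blast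
  qed
  then have "card X \<le> card (set ` ?L)"
    using finite_lists_length_eq[OF fin] by (intro card_mono) auto
  also have "\<dots> \<le> card ?L"
    by (rule card_image_le[OF finite_lists_length_eq[OF fin]])
  also have "\<dots> = card (vertex_set X) ^ K"
    by (rule card_lists_length_eq[OF fin])
  finally show ?thesis .
qed

lemma listing_bounds:
  assumes X: "abstract_complex X" and dim: "complex_dim X \<le> D" and l: "listing vs ss X"
  shows "\<forall>xs\<in>set ss. length xs \<le> nat (D + 1)"
    and "length ss \<le> card (vertex_set X) ^ nat (D + 1)"
proof -
  have inj: "inj_on ((!) vs) {..<length vs}"
    using l by (auto simp: listing_def intro: inj_on_nth)
  have card: "card \<sigma> \<le> nat (D + 1)" if "\<sigma> \<in> X" for \<sigma>
  proof -
    have "finite X"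
      using X by (simp add: abstract_complex_def)
    with that have "card \<sigma> \<le> Max (card ` X)"
      by simp
    then show ?thesis
      using dim that by (auto simp: complex_dim_def split: if_splits)
  qed
  show "\<forall>xs\<in>set ss. length xs \<le> nat (D + 1)"
  proof
    fix xs
    assume xs: "xs \<in> set ss"
    then have "distinct xs" "set xs \<subseteq> {..<length vs}"
      using l by (auto simp: listing_def)
    then have "card ((!) vs ` set xs) = length xs"
      using card_image[OF inj_on_subset[OF inj]] distinct_card[of xs] by simp
    moreover have "(!) vs ` set xs \<in> X"
      using l xs by (auto simp: listing_def)
    ultimately show "length xs \<le> nat (D + 1)"
      using card[of "(!) vs ` set xs"] by simp
  qed
  \<comment> \<open>Equal images force equal sets of positions, and
    \<open>distinct (map set ss)\<close> then forces equal lists, so \<open>length ss\<close> is the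
    number of simplices.\<close>
  have "inj_on (\<lambda>xs. (!) vs ` set xs) (set ss)"
  proof (rule inj_onI)
    fix xs ys
    assume "xs \<in> set ss" "ys \<in> set ss" "(!) vs ` set xs = (!) vs ` set ys"
    moreover from this have "set xs = set ys"
      using l inj_on_image_eq_iff[OF inj, of "set xs" "set ys"] by (simp add: listing_def)
    ultimately show "xs = ys"
      using l \<open>xs \<in> set ss\<close> \<open>ys \<in> set ss\<close> inj_onD[of set "set ss" xs ys]
      by (simp add: listing_def distinct_map)
  qed
  moreover have "X = (\<lambda>xs. (!) vs ` set xs) ` set ss" "distinct ss"
    using l by (simp_all add: listing_def distinct_map)
  ultimately have "card X = length ss"
    using card_image[of "\<lambda>xs. (!) vs ` set xs" "set ss"] distinct_card[of ss] by simp
  then show "length ss \<le> card (vertex_set X) ^ nat (D + 1)"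
    using card_simplices_le[OF X card] by simp
qed

text \<open>The program is chosen before \<open>D\<close>, so one program serves all dimensions and
  only the constant varies with \<open>D\<close>. The dimension of the ambient space is fixed by the
  type \<open>'d\<close>.\<close>

theorem proposition2p18:
  "\<exists>P :: com. \<forall>D :: int. \<exists>T :: nat \<Rightarrow> nat.
     (\<lambda>p. real (T p)) \<in> O(\<lambda>p. real p ^ nat (2 * D + 2)) \<and>
     (\<forall>(X :: 'v set set) (f :: 'v \<Rightarrow> real ^ 'd) (Y :: 'w set set) (g :: 'w \<Rightarrow> real ^ 'd) vs ss ws ts.
        (X, f) \<in> placed_complexes \<longrightarrow> (Y, g) \<in> placed_complexes \<longrightarrow>
        D = max (complex_dim X) (complex_dim Y) \<longrightarrow>
        listing vs ss X \<longrightarrow> listing ws ts Y \<longrightarrow>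
        (\<exists>t s. exec P (input_state vs ss f ws ts g) t s \<and>
               num s 0 = simplicial_hausdorff (X, f) (Y, g) \<and>
               t \<le> T (max (card (vertex_set X)) (card (vertex_set Y)))))"
proof (intro exI[of _ hausdorff_program] allI)
  fix D :: int
  define K where "K = nat (D + 1)"
  \<comment> \<open>The factor from \<open>run_hausdorff_program\<close>; \<open>K\<close> bounds
    the number of vertices of a simplex.\<close>
  define C where "C = 100 * K * K + 100 * K + 400"
  show "\<exists>T :: nat \<Rightarrow> nat.
     (\<lambda>p. real (T p)) \<in> O(\<lambda>p. real p ^ nat (2 * D + 2)) \<and>
     (\<forall>(X :: 'v set set) (f :: 'v \<Rightarrow> real ^ 'd) (Y :: 'w set set) (g :: 'w \<Rightarrow> real ^ 'd) vs ss ws ts.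
        (X, f) \<in> placed_complexes \<longrightarrow> (Y, g) \<in> placed_complexes \<longrightarrow>
        D = max (complex_dim X) (complex_dim Y) \<longrightarrow>
        listing vs ss X \<longrightarrow> listing ws ts Y \<longrightarrow>
        (\<exists>t s. exec hausdorff_program (input_state vs ss f ws ts g) t s \<and>
               num s 0 = simplicial_hausdorff (X, f) (Y, g) \<and>
               t \<le> T (max (card (vertex_set X)) (card (vertex_set Y)))))"
  proof (intro exI[of _ "\<lambda>p. C * p ^ nat (2 * D + 2)"] conjI allI impI)
    show "(\<lambda>p. real (C * p ^ nat (2 * D + 2))) \<in> O(\<lambda>p. real p ^ nat (2 * D + 2))"
      by simp
  next
    fix X :: "'v set set" and f :: "'v \<Rightarrow> real ^ 'd" and Y :: "'w set set" and g :: "'w \<Rightarrow> real ^ 'd"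
      and vs ss ws ts
    assume "(X, f) \<in> placed_complexes" "(Y, g) \<in> placed_complexes"
      and D: "D = max (complex_dim X) (complex_dim Y)"
      and lX: "listing vs ss X" and lY: "listing ws ts Y"
    then have X: "abstract_complex X" and Y: "abstract_complex Y"
      by (auto simp: placed_complexes_def)
    define p where "p = max (card (vertex_set X)) (card (vertex_set Y))"
    define N where "N = p ^ K"
    let ?s = "input_state vs ss f ws ts g"
    note bX = listing_bounds[OF X _ lX, of D, folded K_def]
    note bY = listing_bounds[OF Y _ lY, of D, folded K_def]
    have "card (vertex_set X) ^ K \<le> N" "card (vertex_set Y) ^ K \<le> N"
      unfolding N_def p_def by (intro power_mono; simp)+
    with bX(2) bY(2) D have N: "length ss \<le> N" "length ts \<le> N"
      by fastforce+
    have "1 \<le> N"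
    proof (cases "X = {} \<and> Y = {}")
      case True
      then show ?thesis
        \<comment> \<open>For two empty complexes \<open>D = -1\<close>, so \<open>K = 0\<close> and
          \<open>N = 0 ^ 0 = 1\<close>.\<close>
        using D by (simp add: N_def K_def complex_dim_def)
    next
      case False
      then have "1 \<le> card X \<or> 1 \<le> card Y"
        using X Y by (auto simp: abstract_complex_def Suc_le_eq card_gt_0_iff)
      then have "ss \<noteq> [] \<or> ts \<noteq> []"
        using lX lY by (auto simp: listing_def)
      then show ?thesis
        using N by (auto simp: Suc_le_eq neq_Nil_conv)
    qed
    moreover have "C * p ^ nat (2 * D + 2) = C * N ^ 2"
    proof -
      \<comment> \<open>Both sides truncate to 0 for \<open>D < -1\<close>, so no lower bound on
        \<open>D\<close> enters.\<close>
      have "nat (2 * D + 2) = K * 2"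
        unfolding K_def by simp
      then show ?thesis
        by (simp add: N_def power_mult)
    qed
    moreover have "simplicial_hausdorff (X, f) (Y, g) =
      sup (SUP xs\<in>set ss. nearest_dist (pt ?s) 0 (length vs) ts xs)
        (SUP ys\<in>set ts. nearest_dist (pt ?s) (length vs) 0 ss ys)"
    proof -
      have P: "i < length vs \<Longrightarrow> pt ?s (0 + i) = f (vs ! i)"
        "j < length ws \<Longrightarrow> pt ?s (length vs + j) = g (ws ! j)" for i j
        by (simp_all add: input_state_def list_memory_def nth_append)
      show ?thesis
        unfolding simplicial_hausdorff_def sup_max
        using directed_dist_listing[OF X lX lY, of "pt ?s" 0 f "length vs" g, OF P]
          directed_dist_listing[OF Y lY lX, of "pt ?s" "length vs" g 0 f, OF P(2) P(1)]
        by simp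
    qed
    moreover have "run hausdorff_program ?s (\<lambda>t s'. t \<le> C * N ^ 2 \<and>
       num s' 0 = sup (SUP xs\<in>set ss. nearest_dist (pt ?s) 0 (length vs) ts xs)
         (SUP ys\<in>set ts. nearest_dist (pt ?s) (length vs) 0 ss ys))"
      unfolding C_def
      by (rule run_hausdorff_program[OF refl]) (use bX bY D N \<open>1 \<le> N\<close> in auto)
    ultimately show "\<exists>t s. exec hausdorff_program ?s t s \<and>
        num s 0 = simplicial_hausdorff (X, f) (Y, g) \<and>
        t \<le> C * max (card (vertex_set X)) (card (vertex_set Y)) ^ nat (2 * D + 2)"
      unfolding run_def p_def[symmetric] by metis
  qed
qed

end
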